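(* Let $(X,d,W)$ be a complete convex metric space and let $T,S:X\to X$ be such that $(T,S)$ is an $(a,\alpha,\lambda)$-enriched interpolative Kannan pair, where $a,\lambda\in[0,1)$ and $\alpha\in(0,1)$. Then the common fixed point problem of the pair $(T,S)$ is well-posed.
   Context: Metric spaces are nonempty. Convex structure: for a metric space $(X,d)$, a continuous function $W:X\times X\times[0,1]\to X$ is a convex structure on $X$ if for all $x,y\in X$ and $\lambda\in[0,1]$, $d(u,W(x,y;\lambda))\le \lambda d(u,x)+(1-\lambda)d(u,y)$ for every $u\in X$. Then $(X,d,W)$ is called a (Takahashi) convex metric space; it is complete if $(X,d)$ is complete. For $a,\lambda\in[0,1)$ and $\alpha\in(0,1)$, a pair $(T,S)$ of mappings $T,S:X\to X$ is an $(a,\alpha,\lambda)$-enriched interpolative Kannan pair if $$d(W(x,Tx;\lambda),W(y,Sy;\lambda))\le a\,[d(x,W(x,Tx;\lambda))]^{\alpha}\,[d(y,W(y,Sy;\lambda))]^{1-\alpha}$$ for all $x,y\in X$. $Fix(T)=\{x\in X: Tx=x\}$. The common fixed point problem of the pair $(T,S)$ is well-posed (with $\lambda$ the parameter of the pair) if $Fix(T)=Fix(S)=\{p\}$ for some $p\in X$, and for every sequence $\{x_n\}_{n=0}^\infty$ in $X$ satisfying $\lim_{n\to\infty}d(W(x_n,Tx_n;\lambda),x_n)=0$ and $\lim_{n\to\infty}d(x_n,W(x_n,Sx_n;\lambda))=0$, one has $\lim_{n\to\infty}x_n=p$. *)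

theory Defs
  imports "HOL-Analysis.Analysis"
begin

text \<open>
  The metric space is a type of class \<open>metric_space\<close>. A map on
  \<open>X \<times> X \<times> [0,1]\<close> is a curried function with a real last argument,
  on which nothing is required outside \<open>[0,1]\<close>.
\<close>

definition convex_structure :: "('a::metric_space \<Rightarrow> 'a \<Rightarrow> real \<Rightarrow> 'a) \<Rightarrow> bool" where
  "convex_structure W \<longleftrightarrow>
     continuous_on (UNIV \<times> UNIV \<times> {0..1}) (\<lambda>(x, y, l). W x y l) \<and>
     (\<forall>x y. \<forall>l\<in>{0..1}. \<forall>u. dist u (W x y l) \<le> l * dist u x + (1 - l) * dist u y)"

text \<open>
  As \<open>0 powr r = 0\<close>, real powers of distances have their usual meaning for
  the exponents \<open>\<alpha>\<close> and \<open>1 - \<alpha>\<close> with \<open>0 < \<alpha> < 1\<close>.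
\<close>

definition enriched_interpolative_Kannan_pair ::
  "('a::metric_space \<Rightarrow> 'a \<Rightarrow> real \<Rightarrow> 'a) \<Rightarrow> real \<Rightarrow> real \<Rightarrow> real \<Rightarrow> ('a \<Rightarrow> 'a) \<Rightarrow> ('a \<Rightarrow> 'a) \<Rightarrow> bool" where
  "enriched_interpolative_Kannan_pair W a \<alpha> l T S \<longleftrightarrow>
     (\<forall>x y. dist (W x (T x) l) (W y (S y) l)
        \<le> a * dist x (W x (T x) l) powr \<alpha> * dist y (W y (S y) l) powr (1 - \<alpha>))"

definition Fix :: "('a \<Rightarrow> 'a) \<Rightarrow> 'a set" where
  "Fix T = {x. T x = x}"

definition well_posed_common_fixed_point_problem ::
  "('a::metric_space \<Rightarrow> 'a \<Rightarrow> real \<Rightarrow> 'a) \<Rightarrow> real \<Rightarrow> ('a \<Rightarrow> 'a) \<Rightarrow> ('a \<Rightarrow> 'a) \<Rightarrow> bool" where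
  "well_posed_common_fixed_point_problem W l T S \<longleftrightarrow>
     (\<exists>p. Fix T = {p} \<and> Fix S = {p} \<and>
        (\<forall>x :: nat \<Rightarrow> 'a.
           (\<lambda>n. dist (W (x n) (T (x n)) l) (x n)) \<longlonglongrightarrow> 0 \<longrightarrow>
           (\<lambda>n. dist (x n) (W (x n) (S (x n)) l)) \<longlonglongrightarrow> 0 \<longrightarrow>
           x \<longlonglongrightarrow> p))"

end

theory Submission
  imports Defs
begin

text \<open>
  Write \<open>A x = W x (T x) l\<close> and \<open>B x = W x (S x) l\<close> for the averaged maps. The
  convexity inequality, together with \<open>l < 1\<close>, shows that averaging does not change
  fixed points (\<open>convex_structure_fixed_iff\<close>), and the hypothesis on the pair
  is a contractive condition on \<open>A\<close> and \<open>B\<close> alone. Its right-hand side is a product of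
  positive powers of the displacements of the two arguments, hence it vanishes
  as soon as one argument is fixed by its map. So if \<open>A p = p\<close>, then \<open>B y = p\<close>
  for every \<open>y\<close>; now \<open>B p = p\<close>, and the same reasoning gives \<open>A x = p\<close> for
  every \<open>x\<close>. In other words, both averaged maps are constant with the same value
  as soon as \<open>A\<close> has a fixed point. Well-posedness is then immediate: the displacement of
  \<open>x n\<close> under \<open>A\<close> is literally its distance to \<open>p\<close>.

  A fixed point of \<open>A\<close> is obtained by applying \<open>A\<close> and \<open>B\<close> alternately. At
  consecutive points of this orbit, the new displacement occurs on both sides of the
  condition; cancelling its power shows that every step shrinks displacements by
  at least the factor \<open>a\<close> (\<open>interpolative_bound_imp_linear_bound\<close>). The orbit is thus Cauchy,
  and the contractive condition identifies its limit as a fixed point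
  (\<open>interpolative_Kannan_pair_constant\<close>).
\<close>

text \<open>
  For \<open>d > 0\<close>, dividing by \<open>d powr (1 - \<alpha>)\<close> leaves \<open>d powr \<alpha> \<le> a * c powr \<alpha>\<close>, and
  \<open>a \<le> a powr \<alpha>\<close> because \<open>a \<le> 1\<close>. The sharp factor \<open>a powr (1 / \<alpha>)\<close> is weakened to
  \<open>a\<close>, which does not depend on the exponent and therefore serves
  for both \<open>\<alpha>\<close> and \<open>1 - \<alpha>\<close>.
\<close>

lemma interpolative_bound_imp_linear_bound:
  fixes a c d \<alpha> :: real
  assumes "0 \<le> a" "a \<le> 1" "0 < \<alpha>" "\<alpha> \<le> 1" "0 \<le> c" "0 \<le> d"
    and bound: "d \<le> a * c powr \<alpha> * d powr (1 - \<alpha>)"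
  shows "d \<le> a * c"
proof (cases "d = 0")
  case True
  then show ?thesis using assms by simp
next
  case False
  then have "0 < d" using \<open>0 \<le> d\<close> by simp
  then have "d powr \<alpha> * d powr (1 - \<alpha>) = d"
    by (simp flip: powr_add)
  then have "d powr \<alpha> * d powr (1 - \<alpha>) \<le> (a * c powr \<alpha>) * d powr (1 - \<alpha>)"
    using bound by simp
  then have "d powr \<alpha> \<le> a * c powr \<alpha>"
    using \<open>0 < d\<close> by simp
  also have "\<dots> \<le> a powr \<alpha> * c powr \<alpha>"
  proof -
    have "a \<le> a powr \<alpha>"
      using powr_mono'[of \<alpha> 1 a] assms by simp
    then show ?thesis
      by (simp add: mult_right_mono)
  qed
  also have "\<dots> = (a * c) powr \<alpha>"
    using assms by (simp add: powr_mult)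
  finally have "d powr \<alpha> \<le> (a * c) powr \<alpha>" .
  then show ?thesis
    using powr_less_mono2[of \<alpha> "a * c" d] assms by force
qed

lemma geometric_steps_imp_Cauchy:
  fixes v :: "nat \<Rightarrow> 'a::metric_space" and a c :: real
  assumes "0 \<le> a" "a < 1"
    and step: "\<And>n. dist (v n) (v (Suc n)) \<le> c * a ^ n"
  shows "Cauchy v"
proof -
  have c: "0 \<le> c"
    using order_trans[OF zero_le_dist step[of 0]] by simp
  have tail: "dist (v m) (v (m + k)) \<le> c * a ^ m / (1 - a)" for m k
  proof -
    have "dist (v m) (v (m + k)) \<le> c * a ^ m * (1 - a ^ k) / (1 - a)"
    proof (induction k)
      case (Suc k)
      have "dist (v m) (v (m + Suc k))
          \<le> dist (v m) (v (m + k)) + dist (v (m + k)) (v (Suc (m + k)))"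
        by (simp add: dist_triangle)
      also have "\<dots> \<le> c * a ^ m * (1 - a ^ k) / (1 - a) + c * a ^ (m + k)"
        using Suc step by (intro add_mono)
      also have "\<dots> = c * a ^ m * (1 - a ^ Suc k) / (1 - a)"
        using assms by (simp add: field_simps power_add)
      finally show ?case .
    qed simp
    also have "\<dots> \<le> c * a ^ m / (1 - a)"
      using assms c by (intro divide_right_mono) (auto intro!: mult_left_le)
    finally show ?thesis .
  qed
  have "(\<lambda>m. c * a ^ m / (1 - a)) \<longlonglongrightarrow> c * 0 / (1 - a)"
    using assms by (intro tendsto_intros LIMSEQ_realpow_zero) auto
  then have lim: "(\<lambda>m. c * a ^ m / (1 - a)) \<longlonglongrightarrow> 0" by simp
  show ?thesis
    unfolding Cauchy_altdef2
  proof (intro allI impI)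
    fix e :: real
    assume "0 < e"
    then obtain M where "c * a ^ M / (1 - a) < e"
      using order_tendstoD(2)[OF lim] by (auto simp: eventually_sequentially)
    then have "dist (v n) (v M) < e" if "n \<ge> M" for n
      using tail[of M "n - M"] that by (simp add: dist_commute)
    then show "\<exists>M. \<forall>n\<ge>M. dist (v n) (v M) < e" by blast
  qed
qed

text \<open>
  The orbit is \<open>u 0, v 0, u 1, v 1, \<dots>\<close> with \<open>v n = A (u n)\<close> and
  \<open>u (n + 1) = B (v n)\<close>. Its limit \<open>p\<close> is fixed by \<open>A\<close> because
  the distance of \<open>A p\<close> to \<open>u (n + 1) = B (v n)\<close> is controlled by a positive power of the
  displacement of \<open>v n\<close>, which tends to zero. Once \<open>p\<close> is fixed, the
  condition collapses both maps to the constant \<open>p\<close>.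
\<close>

lemma interpolative_Kannan_pair_constant:
  fixes A B :: "'a::complete_space \<Rightarrow> 'a" and a \<alpha> :: real
  assumes a: "0 \<le> a" "a < 1" and \<alpha>: "0 < \<alpha>" "\<alpha> < 1"
    and contr: "\<And>x y. dist (A x) (B y)
      \<le> a * dist x (A x) powr \<alpha> * dist y (B y) powr (1 - \<alpha>)"
  obtains p where "\<And>x. A x = p" "\<And>x. B x = p"
proof -
  fix x0 :: 'a
  have displacement_B: "dist (A x) (B (A x)) \<le> a * dist x (A x)" for x
    using contr[of x "A x"] a \<alpha>
    by (intro interpolative_bound_imp_linear_bound[of a \<alpha>]) auto
  have displacement_A: "dist (B y) (A (B y)) \<le> a * dist y (B y)" for y
    using contr[of "B y" y] a \<alpha>
    by (intro interpolative_bound_imp_linear_bound[of a "1 - \<alpha>"])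
       (auto simp: dist_commute mult_ac)
  define u where "u n = ((B \<circ> A) ^^ n) x0" for n
  define v where "v n = A (u n)" for n
  define c where "c = dist (u 0) (v 0)"
  have u_Suc: "u (Suc n) = B (v n)" for n
    by (simp add: u_def v_def)
  have v_step: "dist (v n) (u (Suc n)) \<le> a * dist (u n) (v n)" for n
    using displacement_B[of "u n"] by (simp add: u_Suc v_def)
  have u_step: "dist (u (Suc n)) (v (Suc n)) \<le> a * dist (v n) (u (Suc n))" for n
    using displacement_A[of "v n"] by (simp add: u_Suc v_def)
  have shrink: "a * t \<le> t" if "0 \<le> t" for t
    using mult_right_mono[of a 1 t] a that by simp
  have geometric: "dist (u n) (v n) \<le> c * a ^ n" for n
  proof (induction n)
    case (Suc n)
    have "dist (u (Suc n)) (v (Suc n)) \<le> dist (v n) (u (Suc n))"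
      using u_step[of n] shrink[of "dist (v n) (u (Suc n))"] by simp
    also have "\<dots> \<le> a * (c * a ^ n)"
      using v_step[of n] mult_left_mono[OF Suc a(1)] by simp
    finally show ?case by (simp add: mult_ac)
  qed (simp add: c_def)
  have v_u: "dist (v n) (u (Suc n)) \<le> c * a ^ n" for n
    using v_step[of n] shrink[of "dist (u n) (v n)"] geometric[of n] by simp
  have "dist (v n) (v (Suc n)) \<le> (2 * c) * a ^ n" for n
    using dist_triangle[of "v n" "v (Suc n)" "u (Suc n)"] v_u[of n] u_step[of n]
      shrink[of "dist (v n) (u (Suc n))"] by simp
  then have "Cauchy v"
    using a by (intro geometric_steps_imp_Cauchy[of a v "2 * c"])
  then obtain p where p: "v \<longlonglongrightarrow> p"
    using Cauchy_convergent convergent_def by blast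
  have "(\<lambda>n. c * a ^ n) \<longlonglongrightarrow> c * 0"
    using a by (intro tendsto_intros LIMSEQ_realpow_zero) auto
  then have "(\<lambda>n. c * a ^ n) \<longlonglongrightarrow> 0" by simp
  then have gap: "(\<lambda>n. dist (v n) (B (v n))) \<longlonglongrightarrow> 0"
    by (rule real_tendsto_sandwich[OF _ _ tendsto_const, rotated 2])
       (simp_all add: v_u flip: u_Suc)
  have "(\<lambda>n. dist (A p) (B (v n))) \<longlonglongrightarrow> 0"
  proof (rule real_tendsto_sandwich[OF _ _ tendsto_const[of 0]])
    have "(\<lambda>n. dist (v n) (B (v n)) powr (1 - \<alpha>)) \<longlonglongrightarrow> 0 powr (1 - \<alpha>)"
      using gap \<alpha> by (intro tendsto_powr2) auto
    then have "(\<lambda>n. dist (v n) (B (v n)) powr (1 - \<alpha>)) \<longlonglongrightarrow> 0"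
      by simp
    from tendsto_mult_left[OF this]
    show "(\<lambda>n. a * dist p (A p) powr \<alpha> * dist (v n) (B (v n)) powr (1 - \<alpha>)) \<longlonglongrightarrow> 0"
      by (metis mult_zero_right)
  qed (simp_all add: contr)
  then have "(\<lambda>n. dist (A p) (B (v n)) + dist (v n) (B (v n)) + dist (v n) p) \<longlonglongrightarrow> 0"
    using gap p by (intro tendsto_add_zero) (auto simp flip: tendsto_dist_iff)
  moreover have "dist (A p) p \<le> dist (A p) (B (v n)) + dist (v n) (B (v n)) + dist (v n) p" for n
    using dist_triangle[of "A p" p "B (v n)"] dist_triangle3[of "B (v n)" p "v n"] by simp
  ultimately have "dist (A p) p \<le> 0"
    by (intro LIMSEQ_le_const) auto
  then have A_p: "A p = p" by simp
  have B_const: "B y = p" for y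
    using contr[of p y] A_p by simp
  have A_const: "A x = p" for x
    using contr[of x p] B_const by simp
  from that[OF A_const B_const] show thesis .
qed

text \<open>
  If \<open>W x y l = x\<close>, the convexity inequality seen from \<open>u = y\<close> reads
  \<open>dist y x \<le> l * dist y x\<close>.
\<close>

lemma convex_structure_fixed_iff:
  assumes "convex_structure W" "0 \<le> l" "l < 1"
  shows "W x y l = x \<longleftrightarrow> y = x"
proof -
  have W: "dist u (W x y l) \<le> l * dist u x + (1 - l) * dist u y" for u
    using assms by (auto simp: convex_structure_def)
  show ?thesis
  proof
    assume "W x y l = x"
    then have "(1 - l) * dist y x \<le> 0"
      using W[of y] by (simp add: algebra_simps)
    then show "y = x"
      using \<open>l < 1\<close> by (simp add: mult_le_0_iff)
  next
    assume "y = x"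
    then show "W x y l = x"
      using W[of x] by simp
  qed
qed

theorem theorem3p1p2:
  fixes W :: "'a::complete_space \<Rightarrow> 'a \<Rightarrow> real \<Rightarrow> 'a"
    and T S :: "'a \<Rightarrow> 'a"
    and a \<alpha> l :: real
  assumes "convex_structure W"
    and "0 \<le> a" and "a < 1"
    and "0 \<le> l" and "l < 1"
    and "0 < \<alpha>" and "\<alpha> < 1"
    and "enriched_interpolative_Kannan_pair W a \<alpha> l T S"
  shows "well_posed_common_fixed_point_problem W l T S"
proof -
  obtain p where avg_T: "\<And>x. W x (T x) l = p" and avg_S: "\<And>x. W x (S x) l = p"
    using interpolative_Kannan_pair_constant
        [of a \<alpha> "\<lambda>x. W x (T x) l" "\<lambda>x. W x (S x) l"] assms
    unfolding enriched_interpolative_Kannan_pair_def by metis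
  have "T x = x \<longleftrightarrow> x = p" "S x = x \<longleftrightarrow> x = p" for x
    using convex_structure_fixed_iff[OF assms(1,4,5), of x]
    by (metis avg_T, metis avg_S)
  then have "Fix T = {p}" "Fix S = {p}"
    by (auto simp: Fix_def)
  moreover have "x \<longlonglongrightarrow> p" if "(\<lambda>n. dist (W (x n) (T (x n)) l) (x n)) \<longlonglongrightarrow> 0"
    for x :: "nat \<Rightarrow> 'a"
    using that by (simp add: avg_T dist_commute tendsto_dist_iff[of x])
  ultimately show ?thesis
    unfolding well_posed_common_fixed_point_problem_def by blast
qed

end
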